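(* Let $\alpha>0$. For Young diagrams $\lambda\nearrow\Lambda$ put $p_\alpha(\lambda,\Lambda)=\varkappa_\alpha(\lambda,\Lambda)\varphi(\Lambda)/\varphi(\lambda)$. Then for every Young diagram $\lambda$ the numbers $p_\alpha(\lambda,\Lambda)$, $\Lambda$ ranging over diagrams with $\lambda\nearrow\Lambda$, are positive and sum to $1$, so they are transition probabilities of a Markov chain on Young diagrams started at $\varnothing$; and this chain is central with respect to the multiplicities $\varkappa_\alpha$: for every path $\varnothing=\lambda_0\nearrow\lambda_1\nearrow\dots\nearrow\lambda_n=\Lambda$, the probability of the path is $\varphi(\Lambda)\prod_{k=1}^n\varkappa_\alpha(\lambda_{k-1},\lambda_k)$, so that its ratio to $\prod_k\varkappa_\alpha(\lambda_{k-1},\lambda_k)$ depends only on $\Lambda$ (equivalently, the co-transition probabilities are $\varkappa_\alpha(\lambda,\Lambda)\dim_\alpha\lambda/\dim_\alpha\Lambda$).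
   Context: Young diagrams are sets of boxes $(i,j)$ (row $i$, column $j$); $\lambda'$ is the conjugate; $\lambda\nearrow\Lambda$ means $\Lambda$ is obtained from $\lambda$ by adding one box. For $b=(i,j)\in\lambda$, $a(b)=\lambda_i-j$, $l(b)=\lambda'_j-i$. $\varphi(\lambda)=\prod_{b\in\lambda}(a(b)\alpha+l(b)+1)^{-1}$. If the added box lies in column $j$, $\varkappa_\alpha(\lambda,\Lambda)=\prod_{b}\frac{(a(b)\alpha+l(b)+2)(a(b)\alpha+l(b)+1)}{((a(b)+1)\alpha+l(b)+1)(a(b)\alpha+l(b)+1)}$, the product over boxes $b$ of $\lambda$ in column $j$ (arm/leg lengths in $\lambda$). $\dim_\alpha\varnothing=1$ and $\dim_\alpha\Lambda=\sum_{\lambda\nearrow\Lambda}\varkappa_\alpha(\lambda,\Lambda)\dim_\alpha\lambda$.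
   Formalization: The numerator factor a(b)α+l(b)+1 in ϰ_α is corrected to (a(b)+1)α+l(b); with the printed formula the probabilities for λ=(1) sum to 2/(α+1), not 1, unless α=1, where both formulas agree. *)

theory Defs
  imports "HOL-Probability.Probability"
begin

text \<open>
  Boxes are pairs \<open>(i, j)\<close> (row, column), both coordinates counted from \<open>1\<close>.
\<close>

type_synonym box = "nat \<times> nat"

definition young_diagram :: "box set \<Rightarrow> bool" where
  "young_diagram \<mu> \<longleftrightarrow> finite \<mu> \<and> \<mu> \<subseteq> {1..} \<times> {1..} \<and>
     (\<forall>i j i' j'. (i, j) \<in> \<mu> \<and> 1 \<le> i' \<and> i' \<le> i \<and> 1 \<le> j' \<and> j' \<le> j \<longrightarrow> (i', j') \<in> \<mu>)"

definition row_length :: "box set \<Rightarrow> nat \<Rightarrow> nat" where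
  "row_length \<mu> i = card {j. (i, j) \<in> \<mu>}"

definition conjugate :: "box set \<Rightarrow> box set" where
  "conjugate \<mu> = {(j, i). (i, j) \<in> \<mu>}"

text \<open>
  The natural-number subtractions below do not truncate when the box lies in the diagram.
\<close>

definition arm :: "box set \<Rightarrow> box \<Rightarrow> nat" where
  "arm \<mu> b = row_length \<mu> (fst b) - snd b"

definition leg :: "box set \<Rightarrow> box \<Rightarrow> nat" where
  "leg \<mu> b = row_length (conjugate \<mu>) (snd b) - fst b"

definition covered_by :: "box set \<Rightarrow> box set \<Rightarrow> bool"  (infix "\<nearrow>" 50) where
  "\<mu> \<nearrow> \<Lambda> \<longleftrightarrow> young_diagram \<mu> \<and> young_diagram \<Lambda> \<and> (\<exists>b. b \<notin> \<mu> \<and> \<Lambda> = insert b \<mu>)"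

definition added_column :: "box set \<Rightarrow> box set \<Rightarrow> nat" where
  "added_column \<mu> \<Lambda> = snd (the_elem (\<Lambda> - \<mu>))"

definition jack_phi :: "real \<Rightarrow> box set \<Rightarrow> real" where
  "jack_phi \<alpha> \<mu> = (\<Prod>b\<in>\<mu>. inverse (real (arm \<mu> b) * \<alpha> + real (leg \<mu> b) + 1))"

text \<open>
  The Jack edge multiplicity: the coefficient of \<open>P\<^sub>\<Lambda>\<close> in \<open>p\<^sub>1 P\<^sub>\<mu>\<close> for the monic Jack
  symmetric functions with parameter \<open>\<alpha>\<close>.  The second factor of the numerator is
  \<open>(a + 1) \<alpha> + l\<close>, that is \<open>a \<alpha> + l + \<alpha>\<close>.  It is sometimes misprinted as \<open>a \<alpha> + l + 1\<close>,
  which would cancel against the denominator; then already for the one-box diagram the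
  transition probabilities below would sum to \<open>2 / (\<alpha> + 1)\<close> instead of \<open>1\<close>.
  The value is meaningful only if \<open>\<mu> \<nearrow> \<Lambda>\<close>.
\<close>

definition jack_kappa :: "real \<Rightarrow> box set \<Rightarrow> box set \<Rightarrow> real" where
  "jack_kappa \<alpha> \<mu> \<Lambda> =
     (\<Prod>b\<in>{b \<in> \<mu>. snd b = added_column \<mu> \<Lambda>}.
        ((real (arm \<mu> b) * \<alpha> + real (leg \<mu> b) + 2) * ((real (arm \<mu> b) + 1) * \<alpha> + real (leg \<mu> b))) /
        (((real (arm \<mu> b) + 1) * \<alpha> + real (leg \<mu> b) + 1) * (real (arm \<mu> b) * \<alpha> + real (leg \<mu> b) + 1)))"

function jack_dim :: "real \<Rightarrow> box set \<Rightarrow> real" where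
  "jack_dim \<alpha> \<Lambda> =
     (if \<Lambda> = {} then 1 else (\<Sum>\<mu> | \<mu> \<nearrow> \<Lambda>. jack_kappa \<alpha> \<mu> \<Lambda> * jack_dim \<alpha> \<mu>))"
  by pat_completeness auto
termination
  by (relation "Wellfounded.measure (\<lambda>(\<alpha>, \<Lambda>). card \<Lambda>)")
     (auto simp: covered_by_def young_diagram_def)

declare jack_dim.simps [simp del]

text \<open>The transition matrix, extended by \<open>0\<close> to pairs that are not edges.\<close>

definition jack_trans :: "real \<Rightarrow> box set \<Rightarrow> box set \<Rightarrow> real" where
  "jack_trans \<alpha> \<mu> \<Lambda> =
     (if \<mu> \<nearrow> \<Lambda> then jack_kappa \<alpha> \<mu> \<Lambda> * jack_phi \<alpha> \<Lambda> / jack_phi \<alpha> \<mu> else 0)"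

text \<open>
  \<open>X\<close> is a time-homogeneous Markov chain on the probability space \<open>M\<close>, with (countable) state
  space \<open>S\<close>, transition probabilities \<open>p\<close> and initial state \<open>s\<close>.
\<close>

definition markov_chain ::
  "'s set \<Rightarrow> ('s \<Rightarrow> 's \<Rightarrow> real) \<Rightarrow> 's \<Rightarrow> 'w measure \<Rightarrow> (nat \<Rightarrow> 'w \<Rightarrow> 's) \<Rightarrow> bool" where
  "markov_chain S p s M X \<longleftrightarrow>
     prob_space M \<and>
     (\<forall>n. X n \<in> M \<rightarrow>\<^sub>M count_space S) \<and>
     \<P>(\<omega> in M. X 0 \<omega> = s) = 1 \<and>
     (\<forall>n x. \<forall>y\<in>S. \<P>(\<omega> in M. \<forall>k\<le>n. X k \<omega> = x k) > 0 \<longrightarrow>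
        \<P>(\<omega> in M. X (Suc n) \<omega> = y \<bar> \<forall>k\<le>n. X k \<omega> = x k) = p (x n) y)"

definition young_path :: "nat \<Rightarrow> (nat \<Rightarrow> box set) \<Rightarrow> bool" where
  "young_path n L \<longleftrightarrow> L 0 = {} \<and> (\<forall>k\<in>{1..n}. L (k - 1) \<nearrow> L k)"

definition path_weight ::
  "(box set \<Rightarrow> box set \<Rightarrow> real) \<Rightarrow> nat \<Rightarrow> (nat \<Rightarrow> box set) \<Rightarrow> real" where
  "path_weight \<kappa> n L = (\<Prod>k = 1..n. \<kappa> (L (k - 1)) (L k))"

text \<open>
  Centrality of a random growth process with respect to edge multiplicities \<open>\<kappa>\<close>: the ratio of
  the probability of a path to its weight depends only on the end point.  Paths with the same
  end point automatically have the same length.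
\<close>

definition central ::
  "(box set \<Rightarrow> box set \<Rightarrow> real) \<Rightarrow> 'w measure \<Rightarrow> (nat \<Rightarrow> 'w \<Rightarrow> box set) \<Rightarrow> bool" where
  "central \<kappa> M X \<longleftrightarrow>
     (\<forall>n L L'. young_path n L \<and> young_path n L' \<and> L n = L' n \<longrightarrow>
        \<P>(\<omega> in M. \<forall>k\<le>n. X k \<omega> = L k) / path_weight \<kappa> n L =
        \<P>(\<omega> in M. \<forall>k\<le>n. X k \<omega> = L' k) / path_weight \<kappa> n L')"

end

theory Submission
  imports Defs "HOL-Computational_Algebra.Polynomial"
begin

text \<open>
  Write \<open>u\<^sub>i = \<alpha> \<mu>\<^sub>i - i\<close> and let \<open>n\<close> be the number of rows of \<open>\<mu>\<close>.  If \<open>\<Lambda>\<close> arises by adding a box in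
  row \<open>r\<close>, then only the boxes in the row and the column of the new box contribute to
  \<open>\<kappa>(\<mu>, \<Lambda>) \<phi>(\<Lambda>) / \<phi>(\<mu>)\<close>, and telescoping along the row gives
  \<open>p(\<mu>, \<Lambda>) = P(u\<^sub>r) / \<Prod>\<^bsub>i \<noteq> r, i \<le> n + 1\<^esub> (u\<^sub>r - u\<^sub>i)\<close> with \<open>P(z) = \<Prod>\<^bsub>i \<le> n\<^esub> (z - u\<^sub>i + 1)\<close>.  The right-hand
  side vanishes if no box can be added in row \<open>r\<close>, so the sum of the transition probabilities is the
  sum over all \<open>r \<le> n + 1\<close>, which by Lagrange interpolation is the leading coefficient of \<open>P\<close>.
  In a path probability the factors \<open>\<phi>\<close> telescope, whence centrality; summing over paths gives
  \<open>\<phi>(\<Lambda>) dim(\<Lambda>)\<close> for the probability of visiting \<open>\<Lambda>\<close>, and thus the co-transition probabilities.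
\<close>

subsection \<open>Lagrange interpolation\<close>

text \<open>A polynomial of degree below \<open>card S\<close> equals its Lagrange interpolant at
  the nodes \<open>x r\<close>. Every basis polynomial is monic of degree \<open>card S - 1\<close>,
  so comparing the coefficients in that degree gives the identity.\<close>

lemma sum_divided_difference_eq_coeff:
  fixes P :: "'a::field poly"
  assumes "finite S" and inj: "inj_on x S" and deg: "degree P < card S"
  shows "(\<Sum>r\<in>S. poly P (x r) / (\<Prod>i\<in>S - {r}. x r - x i)) = coeff P (card S - 1)"
proof -
  \<comment> \<open>\<open>B r\<close> is the unnormalised Lagrange basis polynomial,
    \<open>D r\<close> its value at its own node, and \<open>Q\<close> the interpolant of
    \<open>P\<close>.\<close>
  define B where "B = (\<lambda>r. \<Prod>i\<in>S - {r}. [:- x i, 1:])"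
  define D where "D = (\<lambda>r. \<Prod>i\<in>S - {r}. x r - x i)"
  define Q where "Q = (\<Sum>r\<in>S. smult (poly P (x r) / D r) (B r))"
  have degB: "degree (B r) = card S - 1" and monB: "coeff (B r) (card S - 1) = 1"
    if "r \<in> S" for r
  proof -
    have "degree (B r) = (\<Sum>i\<in>S - {r}. degree [:- x i, 1:])"
      unfolding B_def by (rule degree_prod_eq_sum_degree) auto
    also have "\<dots> = card S - 1"
      using that assms(1) by simp
    finally show *: "degree (B r) = card S - 1" .
    have "lead_coeff (B r) = (\<Prod>i\<in>S - {r}. lead_coeff [:- x i, 1:])"
      unfolding B_def by (rule lead_coeff_prod)
    then show "coeff (B r) (card S - 1) = 1"
      using * by simp
  qed
  have B_at: "poly (B r) (x s) = (if r = s then D r else 0)" if "r \<in> S" "s \<in> S" for r s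
    using that assms(1) by (auto simp: B_def D_def poly_prod prod_zero_iff)
  have D_nz: "D r \<noteq> 0" if "r \<in> S" for r
    using that assms(1) inj by (auto simp: D_def prod_zero_iff inj_on_def)
  have PQ: "P = Q"
  proof (rule poly_eqI_degree[where A = "x ` S"])
    fix z assume "z \<in> x ` S"
    then obtain s where s: "s \<in> S" "z = x s" by auto
    have "poly Q z = (\<Sum>r\<in>S. if r = s then poly P (x s) else 0)"
      unfolding Q_def poly_sum s(2)
      by (intro sum.cong refl) (auto simp: B_at s D_nz)
    then show "poly P z = poly Q z"
      using s assms(1) by simp
  next
    show "degree P < card (x ` S)"
      using deg card_image[OF inj] by simp
    have "degree Q \<le> card S - 1"
      unfolding Q_def using degB
      by (intro degree_sum_le assms(1)) (metis degree_smult_le)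
    then show "degree Q < card (x ` S)"
      using deg card_image[OF inj] by simp
  qed
  have "coeff P (card S - 1) = (\<Sum>r\<in>S. poly P (x r) / D r)"
    by (subst PQ) (simp add: Q_def coeff_sum monB del: One_nat_def)
  then show ?thesis by (simp add: D_def)
qed

subsection \<open>Adding a box to a Young diagram\<close>

lemma initial_interval_eq:
  fixes A :: "nat set"
  assumes "finite A" "A \<subseteq> {1..}" "\<And>i j. j \<in> A \<Longrightarrow> 1 \<le> i \<Longrightarrow> i \<le> j \<Longrightarrow> i \<in> A"
  shows "A = {1..card A}"
proof (cases "A = {}")
  case False
  have "A = {1..Max A}"
    using assms(1,2) assms(3)[OF Max_in[OF assms(1) False]] by auto
  then show ?thesis
    by (metis card_atLeastAtMost diff_Suc_1 One_nat_def)
qed simp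

lemma young_diagram_conjugate: "young_diagram \<mu> \<Longrightarrow> young_diagram (conjugate \<mu>)"
proof -
  assume y: "young_diagram \<mu>"
  have "conjugate \<mu> = prod.swap ` \<mu>"
    by (force simp: conjugate_def)
  then have "finite (conjugate \<mu>)"
    using y by (simp add: young_diagram_def)
  with y show ?thesis
    unfolding young_diagram_def by (auto simp: conjugate_def; blast)
qed

lemma finite_row: "finite \<mu> \<Longrightarrow> finite {j. (i, j) \<in> \<mu>}"
  by (rule finite_subset[of _ "snd ` \<mu>"]) force+

text \<open>A row is finite and closed to the left, hence an initial interval. This turns questions
  about boxes into linear arithmetic on row lengths.\<close>

lemma mem_iff_row_length:
  assumes "young_diagram \<mu>"
  shows "(i, j) \<in> \<mu> \<longleftrightarrow> 1 \<le> i \<and> 1 \<le> j \<and> j \<le> row_length \<mu> i"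
proof -
  have "{j. (i, j) \<in> \<mu>} = {1..row_length \<mu> i}"
    unfolding row_length_def
    using assms by (intro initial_interval_eq finite_row) (auto simp: young_diagram_def; blast)+
  then show ?thesis
    using assms by (auto simp: young_diagram_def set_eq_iff)
qed

lemma mem_iff_column_length:
  assumes "young_diagram \<mu>"
  shows "(i, j) \<in> \<mu> \<longleftrightarrow> 1 \<le> i \<and> 1 \<le> j \<and> i \<le> row_length (conjugate \<mu>) j"
  using mem_iff_row_length[OF young_diagram_conjugate[OF assms], of j i]
  by (auto simp: conjugate_def)

lemma row_length_antimono:
  assumes "young_diagram \<mu>" "1 \<le> i" "i \<le> i'"
  shows "row_length \<mu> i' \<le> row_length \<mu> i"
proof (cases "row_length \<mu> i' = 0")
  case False
  then have "(i', row_length \<mu> i') \<in> \<mu>"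
    using assms by (simp add: mem_iff_row_length)
  then have "(i, row_length \<mu> i') \<in> \<mu>"
    using assms False unfolding young_diagram_def
    by (metis One_nat_def Suc_leI not_gr_zero order_refl)
  then show ?thesis
    using assms by (simp add: mem_iff_row_length)
qed simp

lemma row_length_insert:
  assumes "finite \<mu>" "(r, c) \<notin> \<mu>"
  shows "row_length (insert (r, c) \<mu>) i = (if i = r then row_length \<mu> i + 1 else row_length \<mu> i)"
proof -
  have "{j. (i, j) \<in> insert (r, c) \<mu>} = (if i = r then insert c {j. (i, j) \<in> \<mu>} else {j. (i, j) \<in> \<mu>})"
    by auto
  then show ?thesis
    using assms finite_row[OF assms(1)] by (auto simp: row_length_def)
qed

lemma conjugate_insert: "conjugate (insert (r, c) \<mu>) = insert (c, r) (conjugate \<mu>)"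
  by (auto simp: conjugate_def)

text \<open>The first row is a separate case because row 0 of a diagram is empty, so that a
  comparison with it would always fail.\<close>

definition addable :: "box set \<Rightarrow> nat \<Rightarrow> bool" where
  "addable \<mu> r \<longleftrightarrow> 1 \<le> r \<and> (r = 1 \<or> row_length \<mu> r < row_length \<mu> (r - 1))"

definition add_box :: "box set \<Rightarrow> nat \<Rightarrow> box set" where
  "add_box \<mu> r = insert (r, row_length \<mu> r + 1) \<mu>"

lemma new_box_notin: "young_diagram \<mu> \<Longrightarrow> (r, row_length \<mu> r + 1) \<notin> \<mu>"
  by (simp add: mem_iff_row_length)

lemma covered_by_add_box:
  assumes y: "young_diagram \<mu>" and r: "addable \<mu> r"
  shows "\<mu> \<nearrow> add_box \<mu> r"
proof -
  let ?m = "row_length \<mu>"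
  have "(i', j') \<in> add_box \<mu> r"
    if "(i, j) \<in> add_box \<mu> r" "1 \<le> i'" "i' \<le> i" "1 \<le> j'" "j' \<le> j" for i j i' j'
  proof (cases "(i, j) \<in> \<mu>")
    case True
    then show ?thesis
      using that y by (auto simp: add_box_def young_diagram_def)
  next
    case False
    then have ij: "i = r" "j = ?m r + 1"
      using that by (auto simp: add_box_def)
    show ?thesis
    proof (cases "i' = r")
      case True
      then show ?thesis
        using that ij y by (auto simp: add_box_def mem_iff_row_length)
    next
      case False
      then have "i' \<le> r - 1" "r \<noteq> 1" using that ij by auto
      then have "?m r < ?m i'"
        using r row_length_antimono[OF y \<open>1 \<le> i'\<close> \<open>i' \<le> r - 1\<close>] by (auto simp: addable_def)
      then show ?thesis
        using that ij y by (auto simp: add_box_def mem_iff_row_length)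
    qed
  qed
  moreover have "finite (add_box \<mu> r)" "add_box \<mu> r \<subseteq> {1..} \<times> {1..}"
    using y r by (auto simp: add_box_def young_diagram_def addable_def)
  ultimately have "young_diagram (add_box \<mu> r)"
    unfolding young_diagram_def by blast
  then show ?thesis
    using y new_box_notin[OF y, of r] by (auto simp: covered_by_def add_box_def)
qed

text \<open>Covers are parametrised by rows. Since \<Lambda> is closed downwards, the left and upper
  neighbours of the new box lie in \<Lambda> and therefore in \<mu>, which fixes the column and
  makes the row above longer.\<close>

lemma covered_by_iff_add_box:
  "\<mu> \<nearrow> \<Lambda> \<longleftrightarrow> young_diagram \<mu> \<and> (\<exists>r. addable \<mu> r \<and> \<Lambda> = add_box \<mu> r)"
proof
  assume "\<mu> \<nearrow> \<Lambda>"
  then obtain r c where y: "young_diagram \<mu>" "young_diagram \<Lambda>"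
    and b: "(r, c) \<notin> \<mu>" "\<Lambda> = insert (r, c) \<mu>"
    by (auto simp: covered_by_def)
  have dc: "(i', j') \<in> \<Lambda>" if "1 \<le> i'" "i' \<le> r" "1 \<le> j'" "j' \<le> c" for i' j'
    using y(2) that b(2) unfolding young_diagram_def by blast
  have rc: "1 \<le> r" "1 \<le> c" using y(2) b(2) by (auto simp: young_diagram_def)
  then have gt: "row_length \<mu> r < c"
    using b y(1) by (auto simp: mem_iff_row_length)
  have "c = row_length \<mu> r + 1"
  proof (rule ccontr)
    assume "c \<noteq> row_length \<mu> r + 1"
    then have "(r, c - 1) \<in> \<Lambda>" using gt rc by (intro dc) auto
    then have "(r, c - 1) \<in> \<mu>" using b rc by auto
    then show False
      using y(1) gt \<open>c \<noteq> row_length \<mu> r + 1\<close> by (auto simp: mem_iff_row_length)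
  qed
  moreover have "row_length \<mu> r < row_length \<mu> (r - 1)" if "r \<noteq> 1"
  proof -
    have "(r - 1, c) \<in> \<Lambda>" using rc that by (intro dc) auto
    then have "(r - 1, c) \<in> \<mu>" using b rc by auto
    then show ?thesis using y(1) gt by (auto simp: mem_iff_row_length)
  qed
  ultimately show "young_diagram \<mu> \<and> (\<exists>r. addable \<mu> r \<and> \<Lambda> = add_box \<mu> r)"
    using y(1) b(2) rc by (auto simp: addable_def add_box_def)
qed (auto intro: covered_by_add_box)

text \<open>A column ends in row \<open>l\<close> when \<open>j\<close> is bracketed by the lengths
  of rows \<open>l + 1\<close> and \<open>l\<close>. The guard on the last hypothesis admits
  \<open>l = 0\<close>, the empty column.\<close>

lemma column_length_eqI:
  assumes "young_diagram \<mu>" "1 \<le> j" "row_length \<mu> (l + 1) < j" "1 \<le> l \<Longrightarrow> j \<le> row_length \<mu> l"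
  shows "row_length (conjugate \<mu>) j = l"
proof -
  have "(l + 1, j) \<notin> \<mu>"
    using assms(1,3) by (simp add: mem_iff_row_length)
  then have "row_length (conjugate \<mu>) j \<le> l"
    using assms(1,2) mem_iff_column_length[of \<mu> "l + 1" j] by auto
  moreover have "l \<le> row_length (conjugate \<mu>) j"
  proof (cases "1 \<le> l")
    case True
    then have "(l, j) \<in> \<mu>"
      using assms by (simp add: mem_iff_row_length)
    then show ?thesis
      using assms(1) by (simp add: mem_iff_column_length)
  qed auto
  ultimately show ?thesis by simp
qed

lemma new_column_length:
  assumes "young_diagram \<mu>" "addable \<mu> r"
  shows "row_length (conjugate \<mu>) (row_length \<mu> r + 1) = r - 1"
  using assms by (intro column_length_eqI) (auto simp: addable_def)

section \<open>Arms and legs of the enlarged diagram\<close>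

lemma arm_add_box:
  assumes "young_diagram \<mu>" "b \<in> \<mu>"
  shows "arm (add_box \<mu> r) b = arm \<mu> b + (if fst b = r then 1 else 0)"
proof -
  \<comment> \<open>This bound keeps the natural-number subtraction in \<open>arm\<close> exact, so
    a longer row really raises the arm by one.\<close>
  have "snd b \<le> row_length \<mu> (fst b)"
    using assms mem_iff_row_length[of \<mu> "fst b" "snd b"] by simp
  then show ?thesis
    using row_length_insert[OF _ new_box_notin[OF assms(1)]] assms(1)
    by (simp add: arm_def add_box_def young_diagram_def)
qed

lemma column_length_add_box:
  assumes "young_diagram \<mu>"
  shows "row_length (conjugate (add_box \<mu> r)) j =
    (if j = row_length \<mu> r + 1 then row_length (conjugate \<mu>) j + 1 else row_length (conjugate \<mu>) j)"
proof -
  have "finite (conjugate \<mu>)"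
    using young_diagram_conjugate[OF assms] by (simp add: young_diagram_def)
  moreover have "(row_length \<mu> r + 1, r) \<notin> conjugate \<mu>"
    using new_box_notin[OF assms, of r] by (simp add: conjugate_def)
  ultimately show ?thesis
    unfolding add_box_def conjugate_insert by (rule row_length_insert)
qed

lemma leg_add_box:
  assumes "young_diagram \<mu>" "b \<in> \<mu>"
  shows "leg (add_box \<mu> r) b = leg \<mu> b + (if snd b = row_length \<mu> r + 1 then 1 else 0)"
proof -
  have "fst b \<le> row_length (conjugate \<mu>) (snd b)"
    using assms mem_iff_column_length[of \<mu> "fst b" "snd b"] by simp
  then show ?thesis
    unfolding leg_def column_length_add_box[OF assms(1)] by simp
qed

lemma arm_leg_new_box:
  assumes "young_diagram \<mu>" "addable \<mu> r"
  shows "arm (add_box \<mu> r) (r, row_length \<mu> r + 1) = 0"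
    and "leg (add_box \<mu> r) (r, row_length \<mu> r + 1) = 0"
proof -
  show "arm (add_box \<mu> r) (r, row_length \<mu> r + 1) = 0"
    using row_length_insert[OF _ new_box_notin[OF assms(1)], of r r] assms(1)
    by (simp add: arm_def add_box_def young_diagram_def)
  show "leg (add_box \<mu> r) (r, row_length \<mu> r + 1) = 0"
    using assms(2) new_column_length[OF assms]
    by (simp add: leg_def column_length_add_box[OF assms(1)] addable_def)
qed

lemma added_column_add_box:
  assumes "young_diagram \<mu>"
  shows "added_column \<mu> (add_box \<mu> r) = row_length \<mu> r + 1"
proof -
  have "add_box \<mu> r - \<mu> = {(r, row_length \<mu> r + 1)}"
    using new_box_notin[OF assms] by (auto simp: add_box_def)
  then show ?thesis by (simp add: added_column_def)
qed

subsection \<open>Transition probabilities\<close>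

lemma jack_phi_pos: "\<alpha> > 0 \<Longrightarrow> jack_phi \<alpha> \<mu> > 0"
  by (auto simp: jack_phi_def intro!: prod_pos add_nonneg_pos)

lemma jack_kappa_pos: "\<alpha> > 0 \<Longrightarrow> jack_kappa \<alpha> \<mu> \<Lambda> > 0"
  unfolding jack_kappa_def
  by (intro prod_pos ballI divide_pos_pos mult_pos_pos add_nonneg_pos add_pos_nonneg) auto

lemma jack_trans_pos: "\<alpha> > 0 \<Longrightarrow> \<mu> \<nearrow> \<Lambda> \<Longrightarrow> jack_trans \<alpha> \<mu> \<Lambda> > 0"
  by (simp add: jack_trans_def jack_phi_pos jack_kappa_pos)

lemma jack_trans_nonneg: "\<alpha> > 0 \<Longrightarrow> jack_trans \<alpha> \<mu> \<Lambda> \<ge> 0"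
  using jack_trans_pos[of \<alpha> \<mu> \<Lambda>] by (cases "\<mu> \<nearrow> \<Lambda>") (auto simp: jack_trans_def)

text \<open>In the new column the quotient of the \<open>jack_phi\<close> factors is
  \<open>(f b + 1) / (f b + 2)\<close> and cancels two factors of \<open>jack_kappa\<close>. In the
  new row \<open>jack_kappa\<close> has no factor, and only the arm grows by one. All other boxes
  contribute 1.\<close>

lemma jack_trans_add_box:
  fixes \<alpha> :: real
  assumes \<alpha>: "\<alpha> > 0" and y: "young_diagram \<mu>" and r: "addable \<mu> r"
  defines "f \<equiv> \<lambda>b. real (arm \<mu> b) * \<alpha> + real (leg \<mu> b)"
  shows "jack_trans \<alpha> \<mu> (add_box \<mu> r) =
    (\<Prod>b\<in>{b \<in> \<mu>. snd b = row_length \<mu> r + 1}. (f b + \<alpha>) / (f b + \<alpha> + 1)) *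
    (\<Prod>b\<in>{b \<in> \<mu>. fst b = r}. (f b + 1) / (f b + \<alpha> + 1))"
proof -
  let ?c = "row_length \<mu> r + 1"
  have fin: "finite \<mu>" using y by (simp add: young_diagram_def)
  have f: "f b \<ge> 0" for b using \<alpha> by (simp add: f_def)
  \<comment> \<open>A box of both kinds would be the new box itself, so the corrections of arm and
    leg never meet.\<close>
  have not_both: "\<not> (fst b = r \<and> snd b = ?c)" if "b \<in> \<mu>" for b
    using new_box_notin[OF y, of r] that by (metis prod.collapse)
  have phi: "jack_phi \<alpha> (add_box \<mu> r) =
      (\<Prod>b\<in>\<mu>. inverse (f b + (if fst b = r then \<alpha> else 0) + (if snd b = ?c then 1 else 0) + 1))"
  proof -
    have "jack_phi \<alpha> (add_box \<mu> r) =
        (\<Prod>b\<in>\<mu>. inverse (real (arm (add_box \<mu> r) b) * \<alpha> + real (leg (add_box \<mu> r) b) + 1))"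
      unfolding jack_phi_def
      \<comment> \<open>Only the index set is unfolded; arms and legs still refer to
        \<open>add_box \<mu> r\<close>. The new box has arm and leg 0, hence the factor 1.\<close>
      by (subst (1) add_box_def, subst prod.insert)
         (use fin new_box_notin[OF y, of r] arm_leg_new_box[OF y r] in auto)
    also have "\<dots> = (\<Prod>b\<in>\<mu>. inverse (f b + (if fst b = r then \<alpha> else 0) + (if snd b = ?c then 1 else 0) + 1))"
      by (intro prod.cong refl) (auto simp: arm_add_box[OF y] leg_add_box[OF y] f_def algebra_simps)
    finally show ?thesis .
  qed
  \<comment> \<open>Padding the column product with factors 1 lets all three products be merged box
    by box over \<mu>.\<close>
  have kappa: "jack_kappa \<alpha> \<mu> (add_box \<mu> r) =
      (\<Prod>b\<in>\<mu>. if snd b = ?c then ((f b + 2) * (f b + \<alpha>)) / ((f b + \<alpha> + 1) * (f b + 1)) else 1)"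
    unfolding jack_kappa_def added_column_add_box[OF y] prod.inter_filter[OF fin]
    by (intro prod.cong refl) (simp add: f_def algebra_simps)
  have "jack_trans \<alpha> \<mu> (add_box \<mu> r) =
      (\<Prod>b\<in>\<mu>. (if snd b = ?c then ((f b + 2) * (f b + \<alpha>)) / ((f b + \<alpha> + 1) * (f b + 1)) else 1) *
        inverse (f b + (if fst b = r then \<alpha> else 0) + (if snd b = ?c then 1 else 0) + 1) /
        inverse (f b + 1))"
    using covered_by_add_box[OF y r]
    unfolding jack_trans_def kappa phi prod_dividef prod.distrib
    by (simp add: jack_phi_def f_def)
  also have "\<dots> = (\<Prod>b\<in>\<mu>. (if snd b = ?c then (f b + \<alpha>) / (f b + \<alpha> + 1) else 1) *
        (if fst b = r then (f b + 1) / (f b + \<alpha> + 1) else 1))"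
  proof (intro prod.cong refl)
    fix b assume b: "b \<in> \<mu>"
    have "f b + 1 > 0" "f b + 2 > 0" "f b + \<alpha> + 1 > 0" using f[of b] \<alpha> by linarith+
    then show "(if snd b = ?c then ((f b + 2) * (f b + \<alpha>)) / ((f b + \<alpha> + 1) * (f b + 1)) else 1) *
        inverse (f b + (if fst b = r then \<alpha> else 0) + (if snd b = ?c then 1 else 0) + 1) /
        inverse (f b + 1) =
        (if snd b = ?c then (f b + \<alpha>) / (f b + \<alpha> + 1) else 1) *
        (if fst b = r then (f b + 1) / (f b + \<alpha> + 1) else 1)"
      using not_both[OF b] by (auto simp: divide_simps)
  qed
  finally show ?thesis
    by (simp add: prod.distrib prod.inter_filter[OF fin])
qed

text \<open>Up to the shift by 1, this is the \<alpha>-content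
  \<open>(j - 1) * \<alpha> - (i - 1)\<close> of the first free box of row \<open>i\<close>.\<close>

definition row_coord :: "real \<Rightarrow> box set \<Rightarrow> nat \<Rightarrow> real" where
  "row_coord \<alpha> \<mu> i = real (row_length \<mu> i) * \<alpha> - real i"

text \<open>Makes the interpolation nodes distinct: the term \<open>- real i\<close> separates rows
  of equal length.\<close>

lemma row_coord_less:
  assumes "\<alpha> > 0" "young_diagram \<mu>" "1 \<le> i" "i < i'"
  shows "row_coord \<alpha> \<mu> i' < row_coord \<alpha> \<mu> i"
proof -
  have "real (row_length \<mu> i') * \<alpha> \<le> real (row_length \<mu> i) * \<alpha>"
    using row_length_antimono[OF assms(2,3), of i'] assms by (intro mult_right_mono) auto
  moreover have "real i < real i'" using assms by simp
  ultimately show ?thesis unfolding row_coord_def by linarith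
qed

section \<open>Products over the row and the column of the new box\<close>

lemma prod_telescope_Ioc:
  fixes g :: "nat \<Rightarrow> 'a::field"
  assumes "a \<le> b" "\<And>j. a \<le> j \<Longrightarrow> j \<le> b \<Longrightarrow> g j \<noteq> 0"
  shows "(\<Prod>j\<in>{a<..b}. g j / g (j - 1)) = g b / g a"
  using assms
proof (induction b rule: dec_induct)
  case (step b)
  have "{a<..Suc b} = insert (Suc b) {a<..b}" using step by auto
  then show ?case using step by simp
qed simp

text \<open>Row \<open>r\<close> is cut into blocks of columns of equal length. On the block between
  the lengths of rows \<open>r + d + 1\<close> and \<open>r + d\<close> all legs in row
  \<open>r\<close> equal \<open>d\<close>, so numerators and denominators are neighbouring terms of
  one arithmetic progression and telescope. The induction adds one block at a time.\<close>

lemma row_product: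
  fixes \<alpha> :: real
  assumes \<alpha>: "\<alpha> > 0" and y: "young_diagram \<mu>" and r: "1 \<le> r"
  defines "u \<equiv> row_coord \<alpha> \<mu>"
    and "f \<equiv> \<lambda>b. real (arm \<mu> b) * \<alpha> + real (leg \<mu> b)"
  shows "(\<Prod>j\<in>{row_length \<mu> (r + d)<..row_length \<mu> r}. (f (r, j) + 1) / (f (r, j) + \<alpha> + 1)) =
    (\<Prod>l\<in>{r..<r + d}. (u r - u l + 1) / (u r - u (l + 1)))"
proof (induction d)
  case (Suc d)
  let ?m = "row_length \<mu>" and ?l = "r + d"
  define F where "F = (\<lambda>j. (f (r, j) + 1) / (f (r, j) + \<alpha> + 1))"
  \<comment> \<open>On the block with leg \<open>d\<close> this is the numerator
    \<open>f (r, j) + 1\<close>. The explicit formula also makes sense at the left end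
    \<open>?m (?l + 1)\<close>, which lies outside the block.\<close>
  define g where "g = (\<lambda>j. (real (?m r) - real j) * \<alpha> + real d + 1)"
  have le: "?m (?l + 1) \<le> ?m ?l" "?m ?l \<le> ?m r"
    using row_length_antimono[OF y] r by auto
  have g: "g j \<noteq> 0" if "j \<le> ?m r" for j
  proof -
    have "(real (?m r) - real j) * \<alpha> \<ge> 0" using that \<alpha> by simp
    then show ?thesis unfolding g_def by linarith
  qed
  have block: "F j = g j / g (j - 1)" if j: "j \<in> {?m (?l + 1)<..?m ?l}" for j
  proof -
    have "row_length (conjugate \<mu>) j = ?l"
      using j by (intro column_length_eqI[OF y]) auto
    then have "f (r, j) = (real (?m r) - real j) * \<alpha> + real d"
      using j le by (simp add: f_def arm_def leg_def of_nat_diff)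
    moreover have "real (j - 1) = real j - 1" using j by auto
    ultimately show ?thesis
      unfolding F_def g_def by (simp only:) (simp add: algebra_simps)
  qed
  have "(\<Prod>j\<in>{?m (?l + 1)<..?m r}. F j) =
      (\<Prod>j\<in>{?m (?l + 1)<..?m ?l}. F j) * (\<Prod>j\<in>{?m ?l<..?m r}. F j)"
    using le by (subst prod.union_disjoint[symmetric]) (auto intro!: prod.cong)
  also have "(\<Prod>j\<in>{?m (?l + 1)<..?m ?l}. F j) = (\<Prod>j\<in>{?m (?l + 1)<..?m ?l}. g j / g (j - 1))"
    using block by (rule prod.cong[OF refl])
  also have "\<dots> = g (?m ?l) / g (?m (?l + 1))"
    using le g by (intro prod_telescope_Ioc) auto
  also have "\<dots> = (u r - u ?l + 1) / (u r - u (?l + 1))"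
    by (simp add: g_def u_def row_coord_def algebra_simps)
  also have "(\<Prod>j\<in>{?m ?l<..?m r}. F j) = (\<Prod>l\<in>{r..<r + d}. (u r - u l + 1) / (u r - u (l + 1)))"
    using Suc.IH by (simp add: F_def)
  finally show ?case by (simp add: F_def mult.commute)
qed simp

text \<open>Nothing telescopes here: the box in row \<open>i\<close> yields exactly the factor with
  index \<open>i\<close>, its numerator and denominator both with reversed sign.\<close>

lemma column_product:
  fixes \<alpha> :: real
  assumes y: "young_diagram \<mu>" and r: "addable \<mu> r"
  defines "u \<equiv> row_coord \<alpha> \<mu>"
    and "f \<equiv> \<lambda>b. real (arm \<mu> b) * \<alpha> + real (leg \<mu> b)"
  shows "(\<Prod>b\<in>{b \<in> \<mu>. snd b = row_length \<mu> r + 1}. (f b + \<alpha>) / (f b + \<alpha> + 1)) =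
    (\<Prod>i\<in>{1..<r}. (u r - u i + 1) / (u r - u i))"
proof -
  let ?c = "row_length \<mu> r + 1"
  have mem: "(i, ?c) \<in> \<mu> \<longleftrightarrow> i \<in> {1..<r}" for i
    using mem_iff_column_length[OF y, of i ?c] new_column_length[OF y r] r
    by (auto simp: addable_def)
  then have set: "{b \<in> \<mu>. snd b = ?c} = (\<lambda>i. (i, ?c)) ` {1..<r}"
    by (auto simp del: atLeastLessThan_iff)
  have "(f (i, ?c) + \<alpha>) / (f (i, ?c) + \<alpha> + 1) = (u r - u i + 1) / (u r - u i)"
    if i: "i \<in> {1..<r}" for i
  proof -
    have "?c \<le> row_length \<mu> i"
      using mem[of i] i mem_iff_row_length[OF y] by blast
    then have "f (i, ?c) + \<alpha> = - (u r - u i + 1)"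
      using i new_column_length[OF y r]
      by (simp add: f_def u_def arm_def leg_def row_coord_def of_nat_diff algebra_simps)
    moreover from this have "f (i, ?c) + \<alpha> + 1 = - (u r - u i)" by simp
    ultimately show ?thesis by (simp only: minus_divide_divide)
  qed
  then show ?thesis
    unfolding set by (subst prod.reindex) (auto simp: inj_on_def intro!: prod.cong)
qed

text \<open>The column accounts for the rows above \<open>r\<close>, the row product for the rows
  from \<open>r\<close> on. In the latter the denominators are shifted by one row, so they skip
  \<open>r\<close> and reach the empty row \<open>n + 1\<close>.\<close>

lemma jack_trans_eq_divided_difference:
  fixes \<alpha> :: real
  assumes \<alpha>: "\<alpha> > 0" and y: "young_diagram \<mu>" and r: "addable \<mu> r" "r \<le> n + 1"
    and n: "row_length \<mu> (n + 1) = 0"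
  defines "u \<equiv> row_coord \<alpha> \<mu>"
  shows "jack_trans \<alpha> \<mu> (add_box \<mu> r) =
    (\<Prod>i\<in>{1..n}. u r - u i + 1) / (\<Prod>i\<in>{1..n + 1} - {r}. u r - u i)"
proof -
  let ?f = "\<lambda>b. real (arm \<mu> b) * \<alpha> + real (leg \<mu> b)"
  have r1: "1 \<le> r" using r by (simp add: addable_def)
  have set: "{b \<in> \<mu>. fst b = r} = Pair r ` {0<..row_length \<mu> r}"
    using r1 by (auto simp: mem_iff_row_length[OF y])
  \<comment> \<open>With \<open>d = n + 1 - r\<close> the lower end is the length 0 of row
    \<open>n + 1\<close>, so the interval is the whole row.\<close>
  have "(\<Prod>b\<in>{b \<in> \<mu>. fst b = r}. (?f b + 1) / (?f b + \<alpha> + 1)) =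
      (\<Prod>j\<in>{row_length \<mu> (r + (n + 1 - r))<..row_length \<mu> r}. (?f (r, j) + 1) / (?f (r, j) + \<alpha> + 1))"
    unfolding set using r n by (subst prod.reindex) (auto simp: inj_on_def)
  also have "\<dots> = (\<Prod>l\<in>{r..<n + 1}. (u r - u l + 1) / (u r - u (l + 1)))"
    unfolding row_product[OF \<alpha> y r1] using r by (simp add: u_def)
  also have "\<dots> = (\<Prod>l\<in>{r..<n + 1}. u r - u l + 1) / (\<Prod>l\<in>{r + 1..<n + 2}. u r - u l)"
    using prod.shift_bounds_Suc_ivl[of "\<lambda>l. u r - u l" r "n + 1"]
    by (simp add: prod_dividef)
  finally have row: "(\<Prod>b\<in>{b \<in> \<mu>. fst b = r}. (?f b + 1) / (?f b + \<alpha> + 1)) =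
      (\<Prod>l\<in>{r..<n + 1}. u r - u l + 1) / (\<Prod>l\<in>{r + 1..<n + 2}. u r - u l)" .
  have "{1..n} = {1..<r} \<union> {r..<n + 1}" "{1..n + 1} - {r} = {1..<r} \<union> {r + 1..<n + 2}"
    using r1 r(2) by auto
  then have "(\<Prod>i\<in>{1..n}. u r - u i + 1) / (\<Prod>i\<in>{1..n + 1} - {r}. u r - u i) =
      ((\<Prod>i\<in>{1..<r}. u r - u i + 1) * (\<Prod>l\<in>{r..<n + 1}. u r - u l + 1)) /
      ((\<Prod>i\<in>{1..<r}. u r - u i) * (\<Prod>l\<in>{r + 1..<n + 2}. u r - u l))"
    by (simp only:) (subst (1 2) prod.union_disjoint; auto)
  then show ?thesis
    unfolding jack_trans_add_box[OF \<alpha> y r(1)] row column_product[OF y r(1)] u_def[symmetric]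
    by (simp add: prod_dividef)
qed

section \<open>The transition probabilities sum to one\<close>

lemma finite_covers_and_sum_jack_trans:
  fixes \<alpha> :: real
  assumes \<alpha>: "\<alpha> > 0" and y: "young_diagram \<mu>"
  shows "finite {\<Lambda>. \<mu> \<nearrow> \<Lambda>}" and "(\<Sum>\<Lambda> | \<mu> \<nearrow> \<Lambda>. jack_trans \<alpha> \<mu> \<Lambda>) = 1"
proof -
  define n where "n = row_length (conjugate \<mu>) 1"
  define u where "u = row_coord \<alpha> \<mu>"
  define P where "P = (\<Prod>i\<in>{1..n}. [:1 - u i, 1:])"
  define A where "A = {r \<in> {1..n + 1}. addable \<mu> r}"
  have empty_row: "row_length \<mu> i = 0" if "i > n" for i
  proof -
    have "(i, 1) \<notin> \<mu>"
      using that mem_iff_column_length[OF y, of i 1] by (simp add: n_def)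
    then show ?thesis
      using that mem_iff_row_length[OF y, of i 1] by auto
  qed
  \<comment> \<open>Beyond row \<open>n + 1\<close> the preceding row is already empty, so no box
    can be added there.\<close>
  have "addable \<mu> r \<longleftrightarrow> r \<in> A" for r
    using empty_row[of "r - 1"] by (cases "r \<le> n + 1") (auto simp: A_def addable_def)
  then have covers: "{\<Lambda>. \<mu> \<nearrow> \<Lambda>} = add_box \<mu> ` A"
    using y by (auto simp: covered_by_iff_add_box)
  then show "finite {\<Lambda>. \<mu> \<nearrow> \<Lambda>}" by (simp add: A_def)
  have inj: "inj_on (add_box \<mu>) A"
    using new_box_notin[OF y] by (auto simp: inj_on_def add_box_def)
  have poly_P: "poly P (u r) = (\<Prod>i\<in>{1..n}. u r - u i + 1)" for r
    by (auto simp: P_def poly_prod algebra_simps intro!: prod.cong)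
  have "degree P = (\<Sum>i\<in>{1..n}. degree [:1 - u i, 1:])"
    unfolding P_def by (rule degree_prod_eq_sum_degree) auto
  then have deg: "degree P = n" by simp
  have "lead_coeff P = (\<Prod>i\<in>{1..n}. lead_coeff [:1 - u i, 1:])"
    unfolding P_def by (rule lead_coeff_prod)
  then have lead: "coeff P n = 1" using deg by simp
  have "(\<Sum>\<Lambda> | \<mu> \<nearrow> \<Lambda>. jack_trans \<alpha> \<mu> \<Lambda>) = (\<Sum>r\<in>A. jack_trans \<alpha> \<mu> (add_box \<mu> r))"
    unfolding covers by (simp add: sum.reindex[OF inj])
  also have "\<dots> = (\<Sum>r\<in>A. poly P (u r) / (\<Prod>i\<in>{1..n + 1} - {r}. u r - u i))"
    using jack_trans_eq_divided_difference[OF \<alpha> y _ _ empty_row[of "n + 1"], folded u_def]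
    by (intro sum.cong refl) (simp add: A_def poly_P)
  also have "\<dots> = (\<Sum>r\<in>{1..n + 1}. poly P (u r) / (\<Prod>i\<in>{1..n + 1} - {r}. u r - u i))"
  proof (intro sum.mono_neutral_left ballI)
    \<comment> \<open>A row that is not addable is as long as the row above it, so
      \<open>u r = u (r - 1) - 1\<close>, which is a root of \<open>P\<close>.\<close>
    fix r assume r: "r \<in> {1..n + 1} - A"
    then have "r - 1 \<in> {1..n}" "row_length \<mu> r = row_length \<mu> (r - 1)"
      using row_length_antimono[OF y, of "r - 1" r] by (auto simp: A_def addable_def)
    moreover from this have "u r - u (r - 1) + 1 = 0"
      by (auto simp: u_def row_coord_def of_nat_diff)
    ultimately have "poly P (u r) = 0"
      unfolding poly_P by (intro prod_zero) auto
    then show "poly P (u r) / (\<Prod>i\<in>{1..n + 1} - {r}. u r - u i) = 0" by simp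
  qed (auto simp: A_def)
  also have "\<dots> = coeff P (card {1..n + 1} - 1)"
  proof (rule sum_divided_difference_eq_coeff)
    show "inj_on u {1..n + 1}"
      using row_coord_less[OF \<alpha> y] unfolding u_def
      by (intro linorder_inj_onI) (auto simp: less_imp_neq[symmetric])
  qed (use deg in auto)
  also have "\<dots> = 1" using lead by simp
  finally show "(\<Sum>\<Lambda> | \<mu> \<nearrow> \<Lambda>. jack_trans \<alpha> \<mu> \<Lambda>) = 1" .
qed

subsection \<open>Countable Markov chains\<close>

lemma sets_Collect_eq_count_space:
  assumes "X \<in> M \<rightarrow>\<^sub>M count_space S"
  shows "{\<omega> \<in> space M. X \<omega> = a} \<in> sets M"
proof -
  \<comment> \<open>Intersecting with \<open>S\<close> covers states \<open>a\<close> outside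
    \<open>S\<close>, for which the event is empty.\<close>
  have "{\<omega> \<in> space M. X \<omega> = a} = X -` ({a} \<inter> S) \<inter> space M"
    using measurable_space[OF assms] by auto
  moreover have "\<dots> \<in> sets M"
    using assms by (rule measurable_sets) simp
  ultimately show ?thesis by (simp only:)
qed

lemma sets_Collect_path:
  fixes X :: "nat \<Rightarrow> 'w \<Rightarrow> 's"
  assumes "\<And>n. X n \<in> M \<rightarrow>\<^sub>M count_space S"
  shows "{\<omega> \<in> space M. \<forall>k\<le>n. X k \<omega> = x k} \<in> sets M"
proof -
  have "{\<omega> \<in> space M. \<forall>k\<in>{..n}. X k \<omega> = x k} \<in> sets M"
    by (intro sets.sets_Collect_finite_All sets_Collect_eq_count_space[OF assms] finite_atMost)
  then show ?thesis unfolding Ball_def atMost_iff .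
qed

text \<open>The Markov property without division. It also holds for null histories, where both sides
  vanish.\<close>

lemma markov_chain_path_step:
  assumes mc: "markov_chain S p s M X" and y: "y \<in> S"
  shows "\<P>(\<omega> in M. (\<forall>k\<le>n. X k \<omega> = x k) \<and> X (Suc n) \<omega> = y) =
    \<P>(\<omega> in M. \<forall>k\<le>n. X k \<omega> = x k) * p (x n) y"
proof -
  interpret prob_space M using mc by (simp add: markov_chain_def)
  have X: "X k \<in> M \<rightarrow>\<^sub>M count_space S" for k using mc by (simp add: markov_chain_def)
  let ?E = "\<lambda>\<omega>. \<forall>k\<le>n. X k \<omega> = x k"
  show ?thesis
  proof (cases "\<P>(\<omega> in M. ?E \<omega>) > 0")
    case True
    then have "\<P>(\<omega> in M. X (Suc n) \<omega> = y \<bar> ?E \<omega>) = p (x n) y"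
      using mc y by (simp add: markov_chain_def)
    with True show ?thesis
      by (simp add: cond_prob_def field_simps conj_commute)
  next
    case False
    then have 0: "\<P>(\<omega> in M. ?E \<omega>) = 0" by (simp add: zero_less_measure_iff)
    have "\<P>(\<omega> in M. ?E \<omega> \<and> X (Suc n) \<omega> = y) \<le> \<P>(\<omega> in M. ?E \<omega>)"
      by (rule finite_measure_mono[OF _ sets_Collect_path[of X, OF X]]) blast
    with 0 show ?thesis by (simp add: measure_le_0_iff)
  qed
qed

text \<open>\<open>markov_chain\<close> conditions on the full history. Summing over the countably
  many histories that end in \<open>x\<close> leaves a statement about the present state
  alone.\<close>

lemma markov_chain_transition:
  assumes mc: "markov_chain S p s M X" and S: "countable S"
    and xy: "x \<in> S" "y \<in> S" "p x y \<ge> 0"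
  shows "\<P>(\<omega> in M. X n \<omega> = x \<and> X (Suc n) \<omega> = y) = \<P>(\<omega> in M. X n \<omega> = x) * p x y"
proof -
  interpret prob_space M using mc by (simp add: markov_chain_def)
  have X: "X k \<in> M \<rightarrow>\<^sub>M count_space S" for k using mc by (simp add: markov_chain_def)
  \<comment> \<open>Histories are extensional functions on \<open>{..n}\<close>: this makes them
    countable, and distinct ones describe disjoint events.\<close>
  define I where "I = {h \<in> {..n} \<rightarrow>\<^sub>E S. h n = x}"
  define E where "E = (\<lambda>h. {\<omega> \<in> space M. \<forall>k\<le>n. X k \<omega> = h k})"
  define F where "F = {\<omega> \<in> space M. X (Suc n) \<omega> = y}"
  have E: "E h \<in> sets M" for h unfolding E_def using sets_Collect_path[of X, OF X] .
  have F: "F \<in> sets M" unfolding F_def using sets_Collect_eq_count_space[OF X] .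
  have "countable ({..n} \<rightarrow>\<^sub>E S)" using S by (intro countable_PiE) auto
  then have I: "countable I" unfolding I_def by (rule countable_subset[rotated]) auto
  have disj: "disjoint_family_on E I"
    unfolding disjoint_family_on_def
  proof (intro ballI impI)
    fix g h assume gh: "g \<in> I" "h \<in> I" "g \<noteq> h"
    then obtain k where "k \<in> {..n}" "g k \<noteq> h k"
      using PiE_ext[of g "{..n}" "\<lambda>_. S" h] by (auto simp: I_def)
    then show "E g \<inter> E h = {}" by (auto simp: E_def)
  qed
  then have disj': "disjoint_family_on (\<lambda>h. E h \<inter> F) I"
    unfolding disjoint_family_on_def by blast
  have UN: "{\<omega> \<in> space M. X n \<omega> = x} = (\<Union>h\<in>I. E h)"
  proof (intro set_eqI iffI)
    fix \<omega> assume \<omega>: "\<omega> \<in> {\<omega> \<in> space M. X n \<omega> = x}"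
    then have "restrict (\<lambda>k. X k \<omega>) {..n} \<in> I"
      using measurable_space[OF X, of \<omega>] by (auto simp: I_def)
    moreover have "\<omega> \<in> E (restrict (\<lambda>k. X k \<omega>) {..n})" using \<omega> by (auto simp: E_def)
    ultimately show "\<omega> \<in> (\<Union>h\<in>I. E h)" by blast
  qed (auto simp: E_def I_def)
  have step: "emeasure M (E h \<inter> F) = emeasure M (E h) * ennreal (p x y)" if "h \<in> I" for h
  proof -
    have "E h \<inter> F = {\<omega> \<in> space M. (\<forall>k\<le>n. X k \<omega> = h k) \<and> X (Suc n) \<omega> = y}"
      by (auto simp: E_def F_def)
    then show ?thesis
      using markov_chain_path_step[OF mc xy(2), of n h] that xy(3)
      by (simp add: emeasure_eq_measure ennreal_mult E_def I_def)
  qed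
  have "{\<omega> \<in> space M. X n \<omega> = x \<and> X (Suc n) \<omega> = y} = (\<Union>h\<in>I. E h \<inter> F)"
    using UN by (auto simp: F_def set_eq_iff)
  then have "emeasure M {\<omega> \<in> space M. X n \<omega> = x \<and> X (Suc n) \<omega> = y} =
      (\<integral>\<^sup>+h. emeasure M (E h \<inter> F) \<partial>count_space I)"
    using emeasure_UN_countable[OF _ I disj'] E F by auto
  also have "\<dots> = (\<integral>\<^sup>+h. emeasure M (E h) * ennreal (p x y) \<partial>count_space I)"
    using step by (intro nn_integral_cong) auto
  also have "\<dots> = (\<integral>\<^sup>+h. emeasure M (E h) \<partial>count_space I) * ennreal (p x y)"
    by (rule nn_integral_multc) auto
  also have "(\<integral>\<^sup>+h. emeasure M (E h) \<partial>count_space I) = emeasure M {\<omega> \<in> space M. X n \<omega> = x}"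
    unfolding UN using emeasure_UN_countable[OF _ I disj] E by auto
  finally show ?thesis
    using xy(3) by (simp add: emeasure_eq_measure ennreal_mult[symmetric])
qed

text \<open>Total probability over the state at time \<open>n\<close>. The finite set
  \<open>A\<close> contains all predecessors from which \<open>y\<close> can be reached, so the
  countable sum collapses to a finite one.\<close>

lemma markov_chain_marginal_step:
  assumes mc: "markov_chain S p s M X" and S: "countable S"
    and y: "y \<in> S" and A: "finite A" "A \<subseteq> S"
    and p: "\<And>x. x \<in> S \<Longrightarrow> p x y \<ge> 0" "\<And>x. x \<in> S \<Longrightarrow> x \<notin> A \<Longrightarrow> p x y = 0"
  shows "\<P>(\<omega> in M. X (Suc n) \<omega> = y) = (\<Sum>x\<in>A. \<P>(\<omega> in M. X n \<omega> = x) * p x y)"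
proof -
  interpret prob_space M using mc by (simp add: markov_chain_def)
  have X: "X k \<in> M \<rightarrow>\<^sub>M count_space S" for k using mc by (simp add: markov_chain_def)
  define E where "E = (\<lambda>x. {\<omega> \<in> space M. X n \<omega> = x \<and> X (Suc n) \<omega> = y})"
  have E: "E x \<in> sets M" for x
    unfolding E_def using sets_Collect_eq_count_space[OF X] by (intro sets.sets_Collect_conj)
  have E_eq: "emeasure M (E x) = ennreal (\<P>(\<omega> in M. X n \<omega> = x) * p x y)" if "x \<in> S" for x
    using markov_chain_transition[OF mc S that y p(1)[OF that], of n]
    by (simp add: E_def emeasure_eq_measure)
  have "{\<omega> \<in> space M. X (Suc n) \<omega> = y} = (\<Union>x\<in>S. E x)"
    using measurable_space[OF X] by (auto simp: E_def)
  moreover have "disjoint_family_on E S" by (auto simp: disjoint_family_on_def E_def)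
  ultimately have "emeasure M {\<omega> \<in> space M. X (Suc n) \<omega> = y} =
      (\<integral>\<^sup>+x. emeasure M (E x) \<partial>count_space S)"
    using emeasure_UN_countable[of S E M] S E by auto
  also have "\<dots> = (\<Sum>x\<in>A. emeasure M (E x))"
    using A p(2) by (intro nn_integral_count_space') (auto simp: E_eq)
  also have "\<dots> = (\<Sum>x\<in>A. ennreal (\<P>(\<omega> in M. X n \<omega> = x) * p x y))"
    using A by (intro sum.cong refl E_eq) auto
  also have "\<dots> = ennreal (\<Sum>x\<in>A. \<P>(\<omega> in M. X n \<omega> = x) * p x y)"
    using A p(1) by (intro sum_ennreal) auto
  finally show ?thesis
    using A p(1) by (simp add: emeasure_eq_measure sum_nonneg subset_iff)
qed

text \<open>
  The chain is driven by independent samples \<open>\<omega> (n, x)\<close> of \<open>K x\<close>, one for every time and every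
  state, so that a path event is a cylinder of the product measure.  The guard keeps the path in
  \<open>S\<close> on the null event that some sample leaves \<open>S\<close>.
\<close>

lemma markov_chain_exists:
  fixes K :: "'s \<Rightarrow> 's pmf"
  assumes S: "countable S" "s \<in> S"
    and K: "\<And>x. x \<in> S \<Longrightarrow> set_pmf (K x) \<subseteq> S"
    and p: "\<And>x y. x \<in> S \<Longrightarrow> y \<in> S \<Longrightarrow> pmf (K x) y = p x y"
  shows "\<exists>(M :: (nat \<Rightarrow> 's) measure) X. markov_chain S p s M X"
proof -
  define g where "g = (\<lambda>y. if y \<in> S then y else s)"
  define N where "N = PiM (UNIV :: (nat \<times> 's) set) (\<lambda>i. measure_pmf (K (snd i)))"
  define Z where "Z = (\<lambda>\<omega>. rec_nat s (\<lambda>n x. g (\<omega> (n, x))) :: nat \<Rightarrow> 's)"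
  define Q where "Q = PiM (UNIV :: nat set) (\<lambda>_. count_space S)"
  have Z0: "Z \<omega> 0 = s" and ZS: "Z \<omega> (Suc n) = g (\<omega> (n, Z \<omega> n))" for \<omega> n
    by (simp_all add: Z_def)
  interpret product_prob_space "\<lambda>i. measure_pmf (K (snd i))" "UNIV :: (nat \<times> 's) set"
    by unfold_locales
  interpret N: prob_space N unfolding N_def by unfold_locales
  have Zm: "(\<lambda>\<omega>. Z \<omega> n) \<in> N \<rightarrow>\<^sub>M count_space S" for n
  proof (induction n)
    case 0
    then show ?case using S by (simp add: Z0)
  next
    case (Suc n)
    have "(\<lambda>\<omega>. g (\<omega> (n, x))) \<in> N \<rightarrow>\<^sub>M count_space S" for x
    proof -
      have "(\<lambda>\<omega>. \<omega> (n, x)) \<in> N \<rightarrow>\<^sub>M measure_pmf (K (snd (n, x)))"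
        unfolding N_def by (rule measurable_component_singleton) simp
      moreover have "g \<in> measure_pmf (K (snd (n, x))) \<rightarrow>\<^sub>M count_space S"
        using S by (auto simp: g_def)
      ultimately show ?thesis by (rule measurable_compose)
    qed
    then show ?case
      unfolding ZS using Suc S(1) by (rule measurable_compose_countable')
  qed
  have ZQ: "Z \<in> N \<rightarrow>\<^sub>M Q"
    unfolding Q_def using Zm by (rule measurable_abs_UNIV)
  \<comment> \<open>The pushforward to path space is a measure of the required type, with the
    coordinates as the chain.\<close>
  define M where "M = distr N Q Z"
  have spM: "space M = space Q" and setsM: "sets M = sets Q" by (simp_all add: M_def)
  have Xm: "(\<lambda>\<omega>. \<omega> n) \<in> M \<rightarrow>\<^sub>M count_space S" for n
    unfolding measurable_cong_sets[OF setsM refl] Q_def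
    by (rule measurable_component_singleton) simp
  have prob_M: "\<P>(\<omega> in M. \<forall>k\<le>n. \<omega> k = x k) = \<P>(\<omega> in N. \<forall>k\<le>n. Z \<omega> k = x k)" for n x
  proof -
    define A where "A = {\<omega> \<in> space M. \<forall>k\<le>n. \<omega> k = x k}"
    have "A \<in> sets M"
      unfolding A_def by (rule sets_Collect_path[of "\<lambda>n \<omega>. \<omega> n", OF Xm])
    then have "measure M A = measure N (Z -` A \<inter> space N)"
      unfolding setsM unfolding M_def by (rule measure_distr[OF ZQ])
    also have "Z -` A \<inter> space N = {\<omega> \<in> space N. \<forall>k\<le>n. Z \<omega> k = x k}"
      unfolding A_def spM using measurable_space[OF ZQ] by blast
    finally show ?thesis unfolding A_def .
  qed
  \<comment> \<open>Samples of \<open>K x\<close> lie in \<open>S\<close> almost surely, so the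
    guard \<open>g\<close> does not change their law.\<close>
  have g_K: "measure (measure_pmf (K x)) (g -` {y}) = p x y" if "x \<in> S" "y \<in> S" for x y
  proof -
    have "map_pmf g (K x) = K x"
      using K[OF that(1)] by (intro map_pmf_idI) (auto simp: g_def)
    then have "measure (measure_pmf (K x)) (g -` {y}) = measure (measure_pmf (K x)) {y}"
      by (metis measure_map_pmf)
    then show ?thesis using p[OF that] by (simp add: measure_pmf_single)
  qed
  have path: "\<P>(\<omega> in M. \<forall>k\<le>n. \<omega> k = x k) = (\<Prod>k<n. p (x k) (x (Suc k)))"
    if x: "x 0 = s" "\<And>k. k \<le> n \<Longrightarrow> x k \<in> S" for n x
  proof -
    \<comment> \<open>Following \<open>x\<close> uses at time \<open>k\<close> only the sample with
      index \<open>(k, x k)\<close>. These indices differ for different times, so the samples are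
      independent.\<close>
    define J where "J = (\<lambda>k. (k, x k)) ` {..<n}"
    define A where "A = (\<lambda>i :: nat \<times> 's. g -` {x (Suc (fst i))})"
    have "(\<forall>k\<le>m. Z \<omega> k = x k) \<longleftrightarrow> (\<forall>k<m. g (\<omega> (k, x k)) = x (Suc k))" for m \<omega>
    proof (induction m)
      case (Suc m)
      have "(\<forall>k\<le>Suc m. Z \<omega> k = x k) \<longleftrightarrow> (\<forall>k\<le>m. Z \<omega> k = x k) \<and> Z \<omega> (Suc m) = x (Suc m)"
        by (auto simp: le_Suc_eq)
      also have "\<dots> \<longleftrightarrow> (\<forall>k\<le>m. Z \<omega> k = x k) \<and> g (\<omega> (m, x m)) = x (Suc m)"
        by (auto simp: ZS)
      finally show ?case using Suc by (auto simp: less_Suc_eq)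
    qed (simp add: Z0 x)
    then have "{\<omega> \<in> space N. \<forall>k\<le>n. Z \<omega> k = x k} =
        {\<omega> \<in> space N. \<forall>i\<in>J. \<omega> i \<in> A i}"
      by (auto simp: J_def A_def)
    also have "\<dots> = prod_emb UNIV (\<lambda>i. measure_pmf (K (snd i))) J (Pi\<^sub>E J A)"
      unfolding prod_emb_def N_def by (auto simp: space_PiM Pi_iff)
    finally have "\<P>(\<omega> in N. \<forall>k\<le>n. Z \<omega> k = x k) = (\<Prod>i\<in>J. measure (measure_pmf (K (snd i))) (A i))"
      unfolding N_def by (simp only:) (rule measure_PiM_emb, auto simp: J_def)
    also have "\<dots> = (\<Prod>k<n. measure (measure_pmf (K (x k))) (g -` {x (Suc k)}))"
      unfolding J_def A_def by (subst prod.reindex) (auto simp: inj_on_def)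
    also have "\<dots> = (\<Prod>k<n. p (x k) (x (Suc k)))"
      using x by (intro prod.cong refl g_K) auto
    finally show ?thesis unfolding prob_M .
  qed
  have "markov_chain S p s M (\<lambda>n \<omega>. \<omega> n)"
    unfolding markov_chain_def
  proof (intro conjI allI ballI impI)
    show "prob_space M" unfolding M_def using ZQ by (rule N.prob_space_distr)
    show "(\<lambda>\<omega>. \<omega> n) \<in> M \<rightarrow>\<^sub>M count_space S" for n by (rule Xm)
    show "\<P>(\<omega> in M. \<omega> 0 = s) = 1" using path[of "\<lambda>_. s" 0] S by simp
    fix n x y
    assume y: "y \<in> S" and pos: "0 < \<P>(\<omega> in M. \<forall>k\<le>n. \<omega> k = x k)"
    \<comment> \<open>An event of positive probability contains some \<omega>. Its trajectory shows
      that \<open>x\<close> starts in \<open>s\<close> and stays in \<open>S\<close>, as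
      \<open>path\<close> demands.\<close>
    then have "{\<omega> \<in> space N. \<forall>k\<le>n. Z \<omega> k = x k} \<noteq> {}"
      unfolding prob_M by (metis less_irrefl measure_empty)
    then obtain \<omega> where \<omega>: "\<omega> \<in> space N" "\<And>k. k \<le> n \<Longrightarrow> Z \<omega> k = x k" by auto
    have x0: "x 0 = s" using \<omega>(2)[of 0] Z0[of \<omega>] by simp
    have xS: "x k \<in> S" if "k \<le> n" for k
      using \<omega>(2)[OF that] measurable_space[OF Zm \<omega>(1), of k] by simp
    define x' where "x' = x(Suc n := y)"
    have "\<P>(\<omega> in M. \<omega> (Suc n) = y \<and> (\<forall>k\<le>n. \<omega> k = x k)) = \<P>(\<omega> in M. \<forall>k\<le>Suc n. \<omega> k = x' k)"
      by (intro arg_cong[where f = "measure M"]) (auto simp: x'_def le_Suc_eq)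
    also have "\<dots> = (\<Prod>k<Suc n. p (x' k) (x' (Suc k)))"
      using x0 xS y by (intro path) (auto simp: x'_def le_Suc_eq)
    also have "\<dots> = (\<Prod>k<n. p (x k) (x (Suc k))) * p (x n) y"
      by (simp add: x'_def)
    also have "(\<Prod>k<n. p (x k) (x (Suc k))) = \<P>(\<omega> in M. \<forall>k\<le>n. \<omega> k = x k)"
      using path[of x n] x0 xS by simp
    finally show "\<P>(\<omega> in M. \<omega> (Suc n) = y \<bar> \<forall>k\<le>n. \<omega> k = x k) = p (x n) y"
      using pos by (simp add: cond_prob_def)
  qed
  then show ?thesis by (intro exI)
qed

subsection \<open>The Jack growth process\<close>

lemma countable_young_diagrams: "countable {\<mu>. young_diagram \<mu>}"
  by (rule countable_subset[OF _ countable_Collect_finite]) (auto simp: young_diagram_def)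

lemma jack_trans_markov_chain_exists:
  assumes \<alpha>: "\<alpha> > 0"
  shows "\<exists>(M :: (nat \<Rightarrow> box set) measure) X.
    markov_chain {\<mu>. young_diagram \<mu>} (jack_trans \<alpha>) {} M X"
proof (rule markov_chain_exists[where K = "\<lambda>\<mu>. embed_pmf (jack_trans \<alpha> \<mu>)"])
  \<comment> \<open>Only for diagrams do the values sum to 1; elsewhere \<open>embed_pmf\<close>
    carries no information.\<close>
  have pmf: "pmf (embed_pmf (jack_trans \<alpha> \<mu>)) \<Lambda> = jack_trans \<alpha> \<mu> \<Lambda>"
    if "young_diagram \<mu>" for \<mu> \<Lambda>
  proof (rule pmf_embed_pmf)
    note covers = finite_covers_and_sum_jack_trans[OF \<alpha> that]
    have "(\<integral>\<^sup>+\<Lambda>. ennreal (jack_trans \<alpha> \<mu> \<Lambda>) \<partial>count_space UNIV) =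
        (\<Sum>\<Lambda> | \<mu> \<nearrow> \<Lambda>. ennreal (jack_trans \<alpha> \<mu> \<Lambda>))"
      using covers(1) by (intro nn_integral_count_space') (auto simp: jack_trans_def)
    also have "\<dots> = 1"
      using covers(2) jack_trans_nonneg[OF \<alpha>] by (subst sum_ennreal) auto
    finally show "(\<integral>\<^sup>+\<Lambda>. ennreal (jack_trans \<alpha> \<mu> \<Lambda>) \<partial>count_space UNIV) = 1" .
  qed (rule jack_trans_nonneg[OF \<alpha>])
  show "pmf (embed_pmf (jack_trans \<alpha> \<mu>)) \<Lambda> = jack_trans \<alpha> \<mu> \<Lambda>"
    if "\<mu> \<in> {\<mu>. young_diagram \<mu>}" for \<mu> \<Lambda>
    using that pmf by simp
  show "set_pmf (embed_pmf (jack_trans \<alpha> \<mu>)) \<subseteq> {\<mu>. young_diagram \<mu>}"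
    if "\<mu> \<in> {\<mu>. young_diagram \<mu>}" for \<mu>
    using that by (auto simp: set_pmf_iff pmf jack_trans_def covered_by_def split: if_splits)
qed (rule countable_young_diagrams, simp add: young_diagram_def)

section \<open>Predecessors of a diagram and positivity of the dimension\<close>

lemma covered_by_card: "\<mu> \<nearrow> \<Lambda> \<Longrightarrow> card \<Lambda> = Suc (card \<mu>)"
  by (auto simp: covered_by_def young_diagram_def)

lemma finite_covered: "young_diagram \<Lambda> \<Longrightarrow> finite {\<mu>. \<mu> \<nearrow> \<Lambda>}"
  by (rule finite_subset[of _ "Pow \<Lambda>"]) (auto simp: covered_by_def young_diagram_def)

text \<open>A box with maximal sum of row and column index has no box to its right or below it, so
  it can be removed.\<close>

lemma ex_covered_by:
  assumes y: "young_diagram \<Lambda>" and "\<Lambda> \<noteq> {}"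
  shows "\<exists>\<mu>. \<mu> \<nearrow> \<Lambda>"
proof -
  let ?h = "\<lambda>b :: box. fst b + snd b"
  have fin: "finite \<Lambda>" using y by (simp add: young_diagram_def)
  then obtain b where b: "b \<in> \<Lambda>" "\<And>c. c \<in> \<Lambda> \<Longrightarrow> ?h c \<le> ?h b"
    using Max_in[of "?h ` \<Lambda>"] Max_ge[of "?h ` \<Lambda>"] \<open>\<Lambda> \<noteq> {}\<close> by fastforce
  have "young_diagram (\<Lambda> - {b})"
    unfolding young_diagram_def
  proof (intro conjI allI impI)
    fix i j i' j'
    assume *: "(i, j) \<in> \<Lambda> - {b} \<and> 1 \<le> i' \<and> i' \<le> i \<and> 1 \<le> j' \<and> j' \<le> j"
    then have "(i', j') \<in> \<Lambda>" using y unfolding young_diagram_def by blast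
    moreover have "(i', j') \<noteq> b" using * b(2)[of "(i, j)"] by auto
    ultimately show "(i', j') \<in> \<Lambda> - {b}" by simp
  qed (use y fin in \<open>auto simp: young_diagram_def\<close>)
  then have "\<Lambda> - {b} \<nearrow> \<Lambda>"
    unfolding covered_by_def using y b(1) by (intro conjI exI[of _ b]) auto
  then show ?thesis by blast
qed

lemma jack_dim_pos:
  assumes "\<alpha> > 0" "young_diagram \<Lambda>"
  shows "jack_dim \<alpha> \<Lambda> > 0"
  using assms(2)
proof (induction "card \<Lambda>" arbitrary: \<Lambda> rule: less_induct)
  case less
  show ?case
  proof (cases "\<Lambda> = {}")
    case False
    have "(\<Sum>\<mu> | \<mu> \<nearrow> \<Lambda>. jack_kappa \<alpha> \<mu> \<Lambda> * jack_dim \<alpha> \<mu>) > 0"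
    proof (rule sum_pos)
      show "{\<mu>. \<mu> \<nearrow> \<Lambda>} \<noteq> {}" using ex_covered_by[OF less.prems False] by blast
      show "0 < jack_kappa \<alpha> \<mu> \<Lambda> * jack_dim \<alpha> \<mu>" if "\<mu> \<in> {\<mu>. \<mu> \<nearrow> \<Lambda>}" for \<mu>
        using that less.hyps[of \<mu>] covered_by_card[of \<mu> \<Lambda>] jack_kappa_pos[OF assms(1)]
        by (auto simp: covered_by_def)
    qed (rule finite_covered[OF less.prems])
    then show ?thesis using False by (subst jack_dim.simps) simp
  qed (simp add: jack_dim.simps)
qed

lemma jack_phi_empty [simp]: "jack_phi \<alpha> {} = 1"
  by (simp add: jack_phi_def)

text \<open>Each step contributes \<open>jack_kappa\<close> times a quotient of consecutive values
  of \<open>jack_phi\<close>; the telescoping starts from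
  \<open>jack_phi \<alpha> {} = 1\<close>.\<close>

lemma prob_path:
  assumes \<alpha>: "\<alpha> > 0"
    and mc: "markov_chain {\<mu>. young_diagram \<mu>} (jack_trans \<alpha>) {} M X"
    and "young_path n L"
  shows "\<P>(\<omega> in M. \<forall>k\<le>n. X k \<omega> = L k) =
    jack_phi \<alpha> (L n) * (\<Prod>k = 1..n. jack_kappa \<alpha> (L (k - 1)) (L k))"
  using assms(3)
proof (induction n)
  case 0
  then show ?case using mc by (simp add: young_path_def markov_chain_def)
next
  case (Suc n)
  then have L: "young_path n L" "L n \<nearrow> L (Suc n)" unfolding young_path_def by (auto dest: bspec[of _ _ "Suc n"])
  have "\<P>(\<omega> in M. \<forall>k\<le>Suc n. X k \<omega> = L k) =
      \<P>(\<omega> in M. (\<forall>k\<le>n. X k \<omega> = L k) \<and> X (Suc n) \<omega> = L (Suc n))"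
    by (intro arg_cong[where f = "measure M"]) (auto simp: le_Suc_eq)
  also have "\<dots> = \<P>(\<omega> in M. \<forall>k\<le>n. X k \<omega> = L k) * jack_trans \<alpha> (L n) (L (Suc n))"
    using L(2) by (intro markov_chain_path_step[OF mc]) (simp add: covered_by_def)
  finally show ?case
    using Suc.IH[OF L(1)] L(2) jack_phi_pos[OF \<alpha>, of "L n"] by (simp add: jack_trans_def)
qed

text \<open>Every transition adds one box, so \<open>card \<Lambda>\<close> is the relevant time.
  Multiplied by \<open>jack_phi \<alpha> \<Lambda>\<close>, the recursion of \<open>jack_dim\<close>
  becomes the recursion of the marginals.\<close>

lemma prob_at_card:
  assumes \<alpha>: "\<alpha> > 0"
    and mc: "markov_chain {\<mu>. young_diagram \<mu>} (jack_trans \<alpha>) {} M X"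
    and "young_diagram \<Lambda>"
  shows "\<P>(\<omega> in M. X (card \<Lambda>) \<omega> = \<Lambda>) = jack_phi \<alpha> \<Lambda> * jack_dim \<alpha> \<Lambda>"
  using assms(3)
proof (induction "card \<Lambda>" arbitrary: \<Lambda>)
  case 0
  then have "\<Lambda> = {}" by (simp add: young_diagram_def)
  then show ?case using mc by (simp add: jack_dim.simps markov_chain_def)
next
  case (Suc n)
  then have ne: "\<Lambda> \<noteq> {}" by auto
  have "\<P>(\<omega> in M. X (Suc n) \<omega> = \<Lambda>) =
      (\<Sum>\<mu> | \<mu> \<nearrow> \<Lambda>. \<P>(\<omega> in M. X n \<omega> = \<mu>) * jack_trans \<alpha> \<mu> \<Lambda>)"
  proof (rule markov_chain_marginal_step[OF mc countable_young_diagrams])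
    show "finite {\<mu>. \<mu> \<nearrow> \<Lambda>}" by (rule finite_covered[OF Suc.prems])
    show "jack_trans \<alpha> \<mu> \<Lambda> \<ge> 0" for \<mu> by (rule jack_trans_nonneg[OF \<alpha>])
    show "jack_trans \<alpha> \<mu> \<Lambda> = 0" if "\<mu> \<notin> {\<mu>. \<mu> \<nearrow> \<Lambda>}" for \<mu>
      using that by (simp add: jack_trans_def)
  qed (use Suc.prems in \<open>auto simp: covered_by_def\<close>)
  also have "\<dots> = (\<Sum>\<mu> | \<mu> \<nearrow> \<Lambda>. jack_phi \<alpha> \<Lambda> * (jack_kappa \<alpha> \<mu> \<Lambda> * jack_dim \<alpha> \<mu>))"
  proof (intro sum.cong refl)
    fix \<mu> assume "\<mu> \<in> {\<mu>. \<mu> \<nearrow> \<Lambda>}"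
    then have \<mu>: "\<mu> \<nearrow> \<Lambda>" by simp
    then have "card \<mu> = n" "young_diagram \<mu>"
      using covered_by_card[OF \<mu>] Suc.hyps(2) by (auto simp: covered_by_def)
    then show "\<P>(\<omega> in M. X n \<omega> = \<mu>) * jack_trans \<alpha> \<mu> \<Lambda> =
        jack_phi \<alpha> \<Lambda> * (jack_kappa \<alpha> \<mu> \<Lambda> * jack_dim \<alpha> \<mu>)"
      using Suc.hyps(1)[of \<mu>] \<mu> jack_phi_pos[OF \<alpha>, of \<mu>] by (simp add: jack_trans_def)
  qed
  also have "\<dots> = jack_phi \<alpha> \<Lambda> * jack_dim \<alpha> \<Lambda>"
    using ne by (subst (2) jack_dim.simps) (simp add: sum_distrib_left)
  finally show ?case using Suc.hyps(2) by simp
qed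

text \<open>Bayes' rule: the joint probability is that of visiting \<mu> times the transition
  probability. After division by the probability of visiting \<Lambda>, all values of
  \<open>jack_phi\<close> cancel.\<close>

lemma co_transition:
  assumes \<alpha>: "\<alpha> > 0"
    and mc: "markov_chain {\<mu>. young_diagram \<mu>} (jack_trans \<alpha>) {} M X"
    and cov: "\<mu> \<nearrow> \<Lambda>"
  shows "\<P>(\<omega> in M. X (card \<mu>) \<omega> = \<mu> \<bar> X (card \<Lambda>) \<omega> = \<Lambda>) =
    jack_kappa \<alpha> \<mu> \<Lambda> * jack_dim \<alpha> \<mu> / jack_dim \<alpha> \<Lambda>"
proof -
  have y: "young_diagram \<mu>" "young_diagram \<Lambda>" using cov by (auto simp: covered_by_def)
  have "\<P>(\<omega> in M. X (card \<mu>) \<omega> = \<mu> \<and> X (card \<Lambda>) \<omega> = \<Lambda>) =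
      jack_phi \<alpha> \<mu> * jack_dim \<alpha> \<mu> * jack_trans \<alpha> \<mu> \<Lambda>"
    using markov_chain_transition[OF mc countable_young_diagrams, of \<mu> \<Lambda> "card \<mu>"]
      y jack_trans_nonneg[OF \<alpha>] prob_at_card[OF \<alpha> mc y(1)] covered_by_card[OF cov] by simp
  then show ?thesis
    using cov jack_phi_pos[OF \<alpha>, of \<mu>] jack_phi_pos[OF \<alpha>, of \<Lambda>]
    by (simp add: cond_prob_def prob_at_card[OF \<alpha> mc y(2)] jack_trans_def)
qed

lemma central_jack:
  assumes \<alpha>: "\<alpha> > 0"
    and mc: "markov_chain {\<mu>. young_diagram \<mu>} (jack_trans \<alpha>) {} M X"
  shows "central (jack_kappa \<alpha>) M X"
proof -
  have "\<P>(\<omega> in M. \<forall>k\<le>n. X k \<omega> = L k) / path_weight (jack_kappa \<alpha>) n L = jack_phi \<alpha> (L n)"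
    if "young_path n L" for n L
  proof -
    \<comment> \<open>Positive weights make the quotient in \<open>central\<close> a genuine one,
      equal to \<open>jack_phi\<close> of the end point.\<close>
    have "path_weight (jack_kappa \<alpha>) n L > 0"
      unfolding path_weight_def by (intro prod_pos ballI jack_kappa_pos \<alpha>)
    then show ?thesis
      unfolding prob_path[OF \<alpha> mc that] path_weight_def[symmetric] by simp
  qed
  then show ?thesis by (simp add: central_def)
qed

theorem theorem7p5:
  fixes \<alpha> :: real
  assumes "\<alpha> > 0"
  shows
    "(\<forall>\<mu>. young_diagram \<mu> \<longrightarrow>
        (\<forall>\<Lambda>. \<mu> \<nearrow> \<Lambda> \<longrightarrow> jack_trans \<alpha> \<mu> \<Lambda> > 0) \<and>
        finite {\<Lambda>. \<mu> \<nearrow> \<Lambda>} \<and> (\<Sum>\<Lambda> | \<mu> \<nearrow> \<Lambda>. jack_trans \<alpha> \<mu> \<Lambda>) = 1) \<and>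
     (\<exists>(M :: (nat \<Rightarrow> box set) measure) X.
        markov_chain {\<mu>. young_diagram \<mu>} (jack_trans \<alpha>) {} M X) \<and>
     (\<forall>(M :: 'w measure) X.
        markov_chain {\<mu>. young_diagram \<mu>} (jack_trans \<alpha>) {} M X \<longrightarrow>
        (\<forall>n L. young_path n L \<longrightarrow>
           \<P>(\<omega> in M. \<forall>k\<le>n. X k \<omega> = L k) =
             jack_phi \<alpha> (L n) * (\<Prod>k = 1..n. jack_kappa \<alpha> (L (k - 1)) (L k)) \<and>
           (\<Prod>k = 1..n. jack_kappa \<alpha> (L (k - 1)) (L k)) > 0) \<and>
        central (jack_kappa \<alpha>) M X \<and>
        (\<forall>\<mu> \<Lambda>. \<mu> \<nearrow> \<Lambda> \<longrightarrow>
           \<P>(\<omega> in M. X (card \<Lambda>) \<omega> = \<Lambda>) > 0 \<and>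
           \<P>(\<omega> in M. X (card \<mu>) \<omega> = \<mu> \<bar> X (card \<Lambda>) \<omega> = \<Lambda>) =
             jack_kappa \<alpha> \<mu> \<Lambda> * jack_dim \<alpha> \<mu> / jack_dim \<alpha> \<Lambda>))"
proof -
  \<comment> \<open>Guarantees that the co-transition probabilities do not condition on a null
    event, where the conditional probability would default to 0.\<close>
  have at_card_pos: "\<P>(\<omega> in M. X (card \<Lambda>) \<omega> = \<Lambda>) > 0"
    if "markov_chain {\<mu>. young_diagram \<mu>} (jack_trans \<alpha>) {} M X" "\<mu> \<nearrow> \<Lambda>"
    for M :: "'w measure" and X \<mu> \<Lambda>
    using that prob_at_card[OF assms that(1)] jack_phi_pos[OF assms] jack_dim_pos[OF assms]
    by (simp add: covered_by_def)
  show ?thesis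
    using jack_trans_markov_chain_exists[OF assms]
    by (intro conjI allI impI)
      (assumption | rule jack_trans_pos[OF assms] finite_covers_and_sum_jack_trans[OF assms]
        prob_path[OF assms] central_jack[OF assms] co_transition[OF assms] at_card_pos
        prod_pos ballI jack_kappa_pos[OF assms])+
qed

end
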